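(* Let $\lambda\in(0,\infty)$ and let $k=k(n)$ satisfy $k\sim\lambda\log n$ as $n\to\infty$. There exist a function $\omega=\omega(n)\gg1$ and a constant $\alpha$ such that, for all $\varepsilon\in(0,1)$, the minimal integer $R_{k,1}$ satisfying $|B_{k,1}(R_{k,1})|\ge n e^{\omega}$ satisfies $$R_{k,1}\sim\alpha k\sim\alpha\lambda\log n\qquad\text{and}\qquad\bigl|B_{k,1}\bigl(\alpha k(1-\varepsilon)\bigr)\bigr|\ll n.$$ In fact, the result holds for any $\omega$ with $1\ll\omega\ll k$.
   Context: $B_{k,1}(R):=\{a\in\mathbb{Z}^k:\sum_{i=1}^k|a_i|\le R\}$ and $|B|$ is the number of elements of $B$. Asymptotic notation is as $n\to\infty$: $a\ll b$ (equivalently $b\gg a$) means $a/b\to0$; $a\sim b$ means $a/b\to1$. Logarithms are natural. *)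

theory Defs
  imports Complex_Main "HOL-Library.FuncSet" "HOL-Library.Landau_Symbols"
begin

(* The radius is real because non-integer radii such as \<alpha> * k * (1 - \<epsilon>) occur.
   Points of \<int>^k are extensional functions on {1..k}. *)
definition l1_ball :: "nat \<Rightarrow> real \<Rightarrow> (nat \<Rightarrow> int) set" where
  "l1_ball k R = {a \<in> {1..k} \<rightarrow>\<^sub>E UNIV. real_of_int (\<Sum>i=1..k. \<bar>a i\<bar>) \<le> R}"

lemma finite_l1_ball: "finite (l1_ball k R)"
proof (rule finite_subset)
  show "l1_ball k R \<subseteq> {1..k} \<rightarrow>\<^sub>E {- \<lfloor>R\<rfloor>..\<lfloor>R\<rfloor>}"
  proof
    fix a assume a: "a \<in> l1_ball k R"
    have "\<bar>a i\<bar> \<le> \<lfloor>R\<rfloor>" if "i \<in> {1..k}" for i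
    proof -
      have "\<bar>a i\<bar> \<le> (\<Sum>i=1..k. \<bar>a i\<bar>)"
        using that by (intro member_le_sum) auto
      also have "\<dots> \<le> \<lfloor>R\<rfloor>"
        using a by (simp add: l1_ball_def le_floor_iff)
      finally show ?thesis .
    qed
    with a show "a \<in> {1..k} \<rightarrow>\<^sub>E {- \<lfloor>R\<rfloor>..\<lfloor>R\<rfloor>}"
      by (auto simp: l1_ball_def PiE_iff abs_le_iff minus_le_iff)
  qed
qed (intro finite_PiE; simp)

(* Balls of negative radius are empty, so for n \<ge> 1 and k \<ge> 1 the set of admissible
   integers is nonempty and bounded below; outside this range it may lack a least
   element, and the value is then unspecified. *)
definition min_radius :: "nat \<Rightarrow> nat \<Rightarrow> real \<Rightarrow> int" where
  "min_radius n k w =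
     (LEAST R :: int. real (card (l1_ball k (real_of_int R))) \<ge> real n * exp w)"

end

theory Submission
  imports Defs
begin

text \<open>
  Write \<open>N k x\<close> for the number of points of the ball of radius \<open>x\<close> in dimension \<open>k\<close>, and put
  \<open>t = 1/\<lambda>\<close>, so that \<open>n = exp (t k + o(k))\<close>. The theorem says that the least radius at which
  \<open>N k x\<close> reaches \<open>exp (t k + o(k))\<close> is asymptotically linear in \<open>k\<close>. No explicit formula for the
  exponential growth rate is used; everything follows from supermultiplicativity,
  \<open>N k x * N l y \<le> N (k + l) (x + y)\<close>, and one crude upper bound.

  Call a slope \<open>a \<ge> 0\<close> supercritical if \<open>N j (a j) > exp (t j)\<close> for at least one \<open>j \<ge> 1\<close>, and let \<open>\<alpha>\<close> be
  the infimum of the supercritical slopes. Above \<open>\<alpha>\<close>, a single witness \<open>j\<close> can be repeated in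
  blocks of coordinates, so \<open>N k (a k)\<close> grows at a rate strictly larger than \<open>t\<close>
  (\<open>supercritical_growth\<close>). Below \<open>\<alpha>\<close>, the bound \<open>N k (b k) \<le> exp (t k)\<close> holds for all \<open>k\<close>,
  and it improves itself: a slope \<open>a < b\<close> leaves room for one extra block of very large slope among
  \<open>m\<close> blocks of slope \<open>a\<close>, whence \<open>N k (a k) \<le> exp ((t - 1/m) k)\<close> (\<open>subcritical_decay\<close>).
  Since \<open>\<omega> = o(k)\<close>, these exponential gaps on both sides of \<open>\<alpha>\<close> absorb the factor \<open>exp \<omega>\<close> and the
  error in \<open>k \<sim> \<lambda> log n\<close>. That \<open>\<alpha>\<close> is positive, so that slopes below it are meaningful, is where the
  upper bound enters: it is the exponential Markov inequality
  \<open>s^x * N k x \<le> ((1 + s) / (1 - s))^k\<close>.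
\<close>

section \<open>Supermultiplicativity of ball sizes\<close>

lemma card_l1_ball_mono:
  assumes "x \<le> y"
  shows "card (l1_ball k x) \<le> card (l1_ball k y)"
  using assms by (intro card_mono finite_l1_ball) (auto simp: l1_ball_def)

lemma l1_ball_floor: "l1_ball k (real_of_int \<lfloor>x\<rfloor>) = l1_ball k x"
  unfolding l1_ball_def by (simp only: of_int_le_iff le_floor_iff)

lemma card_l1_ball_pos:
  assumes "x \<ge> 0"
  shows "card (l1_ball k x) \<ge> 1"
proof -
  have "(\<lambda>i\<in>{1..k}. 0) \<in> l1_ball k x"
    using assms by (simp add: l1_ball_def)
  then have "card (l1_ball k x) > 0"
    using finite_l1_ball card_gt_0_iff by blast
  then show ?thesis by simp
qed

lemma card_l1_ball_supermult:
  "card (l1_ball k x) * card (l1_ball l y) \<le> card (l1_ball (k + l) (x + y))"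
proof -
  define f :: "(nat \<Rightarrow> int) \<times> (nat \<Rightarrow> int) \<Rightarrow> nat \<Rightarrow> int"
    where "f = (\<lambda>(a, b). \<lambda>i\<in>{1..k + l}. if i \<le> k then a i else b (i - k))"
  have sum_f: "(\<Sum>i=1..k + l. \<bar>f (a, b) i\<bar>) = (\<Sum>i=1..k. \<bar>a i\<bar>) + (\<Sum>i=1..l. \<bar>b i\<bar>)" for a b
  proof -
    have "(\<Sum>i=1..k + l. \<bar>f (a, b) i\<bar>) =
        (\<Sum>i=1..k. \<bar>f (a, b) i\<bar>) + (\<Sum>i=k + 1..k + l. \<bar>f (a, b) i\<bar>)"
      by (rule sum.ub_add_nat) simp
    also have "(\<Sum>i=1..k. \<bar>f (a, b) i\<bar>) = (\<Sum>i=1..k. \<bar>a i\<bar>)"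
      by (intro sum.cong) (auto simp: f_def)
    also have "(\<Sum>i=k + 1..k + l. \<bar>f (a, b) i\<bar>) = (\<Sum>i=1..l. \<bar>f (a, b) (i + k)\<bar>)"
      using sum.shift_bounds_cl_nat_ivl[of "\<lambda>i. \<bar>f (a, b) i\<bar>" 1 k l] by (simp add: add.commute)
    also have "\<dots> = (\<Sum>i=1..l. \<bar>b i\<bar>)"
      by (intro sum.cong) (auto simp: f_def)
    finally show ?thesis .
  qed
  have "inj_on f (l1_ball k x \<times> l1_ball l y)"
  proof (rule inj_onI, clarify)
    fix a b c d
    assume mem: "a \<in> l1_ball k x" "b \<in> l1_ball l y" "c \<in> l1_ball k x" "d \<in> l1_ball l y"
      and eq: "f (a, b) = f (c, d)"
    have "a i = c i" if "i \<in> {1..k}" for i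
      using fun_cong[OF eq, of i] that by (auto simp: f_def)
    then have "a = c"
      using mem by (intro PiE_ext[of a "{1..k}" "\<lambda>_. UNIV"]) (auto simp: l1_ball_def)
    moreover have "b i = d i" if "i \<in> {1..l}" for i
      using fun_cong[OF eq, of "i + k"] that by (auto simp: f_def)
    then have "b = d"
      using mem by (intro PiE_ext[of b "{1..l}" "\<lambda>_. UNIV"]) (auto simp: l1_ball_def)
    ultimately show "a = c \<and> b = d" by blast
  qed
  moreover have "f ` (l1_ball k x \<times> l1_ball l y) \<subseteq> l1_ball (k + l) (x + y)"
  proof clarify
    fix a b
    assume mem: "a \<in> l1_ball k x" "b \<in> l1_ball l y"
    have "f (a, b) \<in> {1..k + l} \<rightarrow>\<^sub>E UNIV"
      by (auto simp: f_def)
    moreover have "real_of_int (\<Sum>i=1..k + l. \<bar>f (a, b) i\<bar>) \<le> x + y"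
      unfolding sum_f using mem by (simp add: l1_ball_def)
    ultimately show "f (a, b) \<in> l1_ball (k + l) (x + y)"
      by (simp add: l1_ball_def)
  qed
  ultimately have "card (l1_ball k x \<times> l1_ball l y) \<le> card (l1_ball (k + l) (x + y))"
    by (intro card_inj_on_le finite_l1_ball)
  then show ?thesis by (simp add: card_cartesian_product)
qed

lemma card_l1_ball_power:
  "card (l1_ball k x) ^ m \<le> card (l1_ball (m * k) (real m * x))"
proof (induction m)
  case 0
  show ?case using card_l1_ball_pos[of 0 0] by simp
next
  case (Suc m)
  have "card (l1_ball k x) ^ Suc m \<le> card (l1_ball k x) * card (l1_ball (m * k) (real m * x))"
    using Suc by simp
  also have "\<dots> \<le> card (l1_ball (k + m * k) (x + real m * x))"
    by (rule card_l1_ball_supermult)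
  finally show ?case by (simp add: algebra_simps)
qed

text \<open>Arbitrarily large growth rates occur, already because the one-dimensional ball is unbounded.\<close>

lemma card_l1_ball_rate_unbounded:
  obtains c where "c \<ge> 0" and "\<And>k. exp (u * real k) \<le> real (card (l1_ball k (c * real k)))"
proof -
  obtain m :: nat where m: "exp u \<le> real m"
    using real_arch_simple by blast
  have "inj_on (\<lambda>j. \<lambda>i\<in>{1..1::nat}. int j) {0..m}"
    by (rule inj_onI) (auto dest!: fun_cong[of _ _ 1])
  moreover have "(\<lambda>j. \<lambda>i\<in>{1..1::nat}. int j) ` {0..m} \<subseteq> l1_ball 1 (real m)"
    by (auto simp: l1_ball_def split: if_splits)
  ultimately have "card {0..m} \<le> card (l1_ball 1 (real m))"
    by (intro card_inj_on_le finite_l1_ball)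
  with m have one: "exp u \<le> real (card (l1_ball 1 (real m)))"
    by simp
  have "exp (u * real k) \<le> real (card (l1_ball k (real m * real k)))" for k
  proof -
    have "exp (u * real k) = exp u ^ k"
      by (simp add: exp_of_nat_mult[symmetric] mult.commute)
    also have "\<dots> \<le> real (card (l1_ball 1 (real m))) ^ k"
      by (intro power_mono one) simp
    also have "\<dots> \<le> real (card (l1_ball k (real m * real k)))"
      using card_l1_ball_power[of 1 "real m" k]
      by (simp add: mult.commute flip: of_nat_power)
    finally show ?thesis .
  qed
  then show ?thesis by (intro that[of "real m"]) auto
qed

section \<open>An upper bound on ball sizes\<close>

lemma sum_power_abs_le:
  fixes s :: real
  assumes "0 < s" "s < 1"
  shows "(\<Sum>j\<in>{- int m..int m}. s ^ nat \<bar>j\<bar>) \<le> (1 + s) / (1 - s)"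
proof -
  have "(\<Sum>j\<in>{- int m..int m}. s ^ nat \<bar>j\<bar>) = (1 + s - 2 * s ^ Suc m) / (1 - s)"
  proof (induction m)
    case 0
    show ?case using assms by simp
  next
    case (Suc m)
    have "{- int (Suc m)..int (Suc m)} =
        insert (- int (Suc m)) (insert (int (Suc m)) {- int m..int m})"
      by auto
    then have "(\<Sum>j\<in>{- int (Suc m)..int (Suc m)}. s ^ nat \<bar>j\<bar>) =
        2 * s ^ Suc m + (\<Sum>j\<in>{- int m..int m}. s ^ nat \<bar>j\<bar>)"
      by (simp add: nat_add_distrib)
    also have "\<dots> = (1 + s - 2 * s ^ Suc (Suc m)) / (1 - s)"
      unfolding Suc using assms by (simp add: field_simps)
    finally show ?case .
  qed
  also have "\<dots> \<le> (1 + s) / (1 - s)"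
    using assms by (intro divide_right_mono) auto
  finally show ?thesis .
qed

text \<open>
  The exponential Markov inequality: weight each lattice point \<open>a\<close> by \<open>s\<close> to the power of its norm.
  Points of the ball have weight at least \<open>s powr x\<close>, and the total weight factorises over coordinates.
\<close>

lemma card_l1_ball_upper:
  fixes s x :: real
  assumes s: "0 < s" "s < 1"
  shows "s powr x * real (card (l1_ball k x)) \<le> ((1 + s) / (1 - s)) ^ k"
proof -
  define m where "m = nat \<lfloor>x\<rfloor>"
  define w where "w = (\<lambda>a::nat \<Rightarrow> int. \<Prod>i=1..k. s ^ nat \<bar>a i\<bar>)"
  have sub: "l1_ball k x \<subseteq> {1..k} \<rightarrow>\<^sub>E {- int m..int m}"
  proof
    fix a assume a: "a \<in> l1_ball k x"
    have "\<bar>a i\<bar> \<le> int m" if "i \<in> {1..k}" for i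
    proof -
      have "\<bar>a i\<bar> \<le> (\<Sum>i=1..k. \<bar>a i\<bar>)"
        using that by (intro member_le_sum) auto
      also have "\<dots> \<le> \<lfloor>x\<rfloor>"
        using a by (simp add: l1_ball_def le_floor_iff)
      finally show ?thesis unfolding m_def by linarith
    qed
    with a show "a \<in> {1..k} \<rightarrow>\<^sub>E {- int m..int m}"
      by (auto simp: l1_ball_def PiE_iff abs_le_iff minus_le_iff)
  qed
  have weight: "s powr x \<le> w a" if "a \<in> l1_ball k x" for a
  proof -
    have "real (\<Sum>i=1..k. nat \<bar>a i\<bar>) \<le> x"
      using that by (simp add: l1_ball_def)
    then have "s powr x \<le> s powr real (\<Sum>i=1..k. nat \<bar>a i\<bar>)"
      using s by (intro powr_mono') auto
    also have "\<dots> = w a"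
      unfolding w_def powr_realpow[OF s(1)] by (rule power_sum)
    finally show ?thesis .
  qed
  have "s powr x * real (card (l1_ball k x)) = (\<Sum>a\<in>l1_ball k x. s powr x)"
    by simp
  also have "\<dots> \<le> (\<Sum>a\<in>l1_ball k x. w a)"
    by (intro sum_mono weight)
  also have "\<dots> \<le> (\<Sum>a\<in>{1..k} \<rightarrow>\<^sub>E {- int m..int m}. w a)"
    using s sub by (intro sum_mono2 finite_PiE) (auto simp: w_def intro!: prod_nonneg)
  also have "\<dots> = (\<Prod>i=1..k. \<Sum>j\<in>{- int m..int m}. s ^ nat \<bar>j\<bar>)"
    unfolding w_def by (subst prod_sum_PiE) auto
  also have "\<dots> = (\<Sum>j\<in>{- int m..int m}. s ^ nat \<bar>j\<bar>) ^ k"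
    by simp
  also have "\<dots> \<le> ((1 + s) / (1 - s)) ^ k"
    using s by (intro power_mono sum_power_abs_le sum_nonneg) auto
  finally show ?thesis .
qed

lemma small_slope_bound:
  fixes t :: real
  assumes "t > 0"
  obtains a where "a > 0" and "\<And>k. real (card (l1_ball k (a * real k))) \<le> exp (t * real k)"
proof -
  \<comment> \<open>With \<open>s\<close> as below, \<open>(1 + s) / (1 - s) = exp (t / 2)\<close>; the slope \<open>a\<close> makes \<open>s powr - a\<close>
      contribute the other \<open>exp (t / 2)\<close>.\<close>
  define s where "s = (exp (t / 2) - 1) / (exp (t / 2) + 1)"
  have "exp (t / 2) > 1"
    using assms by simp
  then have "exp (t / 2) - 1 > 0" "exp (t / 2) + 1 > 0"
    by linarith+
  then have s: "0 < s" "s < 1" and quot: "(1 + s) / (1 - s) = exp (t / 2)"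
    unfolding s_def by (simp_all add: field_simps)
  define a where "a = - t / (2 * ln s)"
  have lns: "ln s < 0" using s by simp
  have "a > 0"
    using assms lns by (simp add: a_def divide_pos_neg zero_less_divide_iff)
  moreover have "real (card (l1_ball k (a * real k))) \<le> exp (t * real k)" for k
  proof -
    have "s powr (a * real k) = exp (- (t / 2) * real k)"
      using lns s by (simp add: powr_def a_def field_simps)
    moreover have "((1 + s) / (1 - s)) ^ k = exp (t / 2 * real k)"
      unfolding quot by (simp add: exp_of_nat_mult[symmetric] mult.commute)
    ultimately have "exp (- (t / 2) * real k) * real (card (l1_ball k (a * real k)))
        \<le> exp (t / 2 * real k)"
      using card_l1_ball_upper[OF s, of "a * real k" k] by simp
    then have "exp (t / 2 * real k) * (exp (- (t / 2) * real k) * real (card (l1_ball k (a * real k))))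
        \<le> exp (t / 2 * real k) * exp (t / 2 * real k)"
      by (intro mult_left_mono) auto
    then show ?thesis
      by (simp add: mult.assoc[symmetric] exp_add[symmetric] del: mult.assoc)
  qed
  ultimately show ?thesis by (rule that)
qed

section \<open>The critical slope\<close>

text \<open>
  A single dimension \<open>j\<close> in which the slope \<open>a\<close> beats rate \<open>t\<close> gives a strictly better rate \<open>u\<close> in
  all dimensions: split the coordinates into blocks of length \<open>j\<close> and set the fewer than \<open>j\<close>
  remaining ones to zero, whence the loss of \<open>j\<close> in the exponent.
\<close>

lemma supercritical_growth:
  fixes a t :: real
  assumes "j \<ge> 1" "a \<ge> 0" "t \<ge> 0" and beat: "exp (t * real j) < real (card (l1_ball j (a * real j)))"
  obtains u where "u > t"
    and "\<And>k. exp (u * (real k - real j)) \<le> real (card (l1_ball k (a * real k)))"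
proof -
  let ?N = "real (card (l1_ball j (a * real j)))"
  define u where "u = ln ?N / real j"
  have Npos: "?N > 0"
    using beat exp_gt_zero[of "t * real j"] by linarith
  have "t * real j < ln ?N"
    using beat Npos by (metis exp_less_cancel_iff exp_ln)
  then have u: "u > t"
    using assms(1) by (simp add: u_def field_simps)
  have N: "?N = exp (u * real j)"
    using Npos assms(1) by (simp add: u_def)
  have "exp (u * (real k - real j)) \<le> real (card (l1_ball k (a * real k)))" for k
  proof -
    define q r where "q = k div j" and "r = k mod j"
    have k: "k = q * j + r" and "r < j"
      using assms(1) by (auto simp: q_def r_def)
    have "exp (u * (real k - real j)) \<le> exp (u * (real q * real j))"
      using u \<open>t \<ge> 0\<close> \<open>r < j\<close> by (auto simp: k intro!: mult_left_mono)
    also have "\<dots> = ?N ^ q"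
      unfolding N by (simp add: exp_of_nat_mult[symmetric] mult_ac)
    also have "\<dots> \<le> real (card (l1_ball (q * j) (real q * (a * real j))))"
      using card_l1_ball_power[of j "a * real j" q] by (simp flip: of_nat_power)
    also have "\<dots> \<le> real (card (l1_ball (q * j) (real q * (a * real j))) *
        card (l1_ball r (a * real r)))"
      using card_l1_ball_pos[of "a * real r" r] \<open>a \<ge> 0\<close> by (simp flip: of_nat_mult)
    also have "\<dots> \<le> real (card (l1_ball (q * j + r) (real q * (a * real j) + a * real r)))"
      by (intro of_nat_mono card_l1_ball_supermult)
    also have "real q * (a * real j) + a * real r = a * real k"
      by (simp add: k algebra_simps)
    finally show ?thesis by (simp add: k)
  qed
  with u show ?thesis by (rule that)
qed

text \<open>
  A bound at slope \<open>b\<close> improves at any smaller slope \<open>a\<close>: juxtapose \<open>m\<close> blocks of slope \<open>a\<close> with one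
  block of a slope \<open>c\<close> whose rate is at least \<open>t + 1\<close>. For large \<open>m\<close> the average slope stays below
  \<open>b\<close>, so the surplus of the last block must be paid by the others, \<open>1/m\<close> each.
\<close>

lemma subcritical_decay:
  fixes a b t :: real
  assumes "a < b" and bound: "\<And>k. real (card (l1_ball k (b * real k))) \<le> exp (t * real k)"
  obtains d where "d > 0"
    and "\<And>k. real (card (l1_ball k (a * real k))) \<le> exp ((t - d) * real k)"
proof -
  obtain c where c: "\<And>k. exp ((t + 1) * real k) \<le> real (card (l1_ball k (c * real k)))"
    using card_l1_ball_rate_unbounded[of "t + 1"] by metis
  obtain m0 :: nat where m0: "(c - b) / (b - a) \<le> real m0"
    using real_arch_simple by blast
  define m where "m = Suc m0"
  have "(c - b) / (b - a) \<le> real m" and "m > 0"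
    using m0 by (auto simp: m_def)
  then have m: "real m * a + c \<le> (real m + 1) * b"
    using \<open>a < b\<close> by (simp add: field_simps)
  have "real (card (l1_ball k (a * real k))) \<le> exp ((t - 1 / real m) * real k)" for k
  proof -
    let ?N = "card (l1_ball k (a * real k))"
    have "real ?N ^ m * exp ((t + 1) * real k) \<le> real ?N ^ m * real (card (l1_ball k (c * real k)))"
      by (intro mult_left_mono c) simp
    also have "\<dots> \<le> real (card (l1_ball (m * k) (real m * (a * real k))) *
        card (l1_ball k (c * real k)))"
      using card_l1_ball_power[of k "a * real k" m]
      by (simp add: mult_right_mono flip: of_nat_power)
    also have "\<dots> \<le> real (card (l1_ball (m * k + k) (real m * (a * real k) + c * real k)))"
      by (intro of_nat_mono card_l1_ball_supermult)
    also have "\<dots> \<le> real (card (l1_ball (m * k + k) (b * real (m * k + k))))"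
      using mult_right_mono[OF m, of "real k"]
      by (intro of_nat_mono card_l1_ball_mono) (simp add: algebra_simps)
    also have "\<dots> \<le> exp (t * real (m * k + k))"
      by (rule bound)
    also have "\<dots> = exp ((t - 1 / real m) * real k) ^ m * exp ((t + 1) * real k)"
      using \<open>m > 0\<close>
      by (simp add: exp_of_nat_mult[symmetric] exp_add[symmetric] field_simps)
    finally have "real ?N ^ m \<le> exp ((t - 1 / real m) * real k) ^ m"
      by simp
    then show ?thesis
      using \<open>m > 0\<close> power_mono_iff[of "real ?N" "exp ((t - 1 / real m) * real k)" m] by simp
  qed
  with \<open>m > 0\<close> show ?thesis by (intro that[of "1 / real m"]) auto
qed

lemma critical_slope:
  fixes t :: real
  assumes "t > 0"
  obtains \<alpha> where "\<alpha> > 0"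
    and "\<And>a. a > \<alpha> \<Longrightarrow>
      \<exists>u>t. \<exists>j. \<forall>k. exp (u * (real k - real j)) \<le> real (card (l1_ball k (a * real k)))"
    and "\<And>a. a < \<alpha> \<Longrightarrow>
      \<exists>d>0. \<forall>k. real (card (l1_ball k (a * real k))) \<le> exp ((t - d) * real k)"
proof -
  define S where "S = {a. a \<ge> 0 \<and> (\<exists>j\<ge>1. exp (t * real j) < real (card (l1_ball j (a * real j))))}"
  have up: "a \<in> S" if ab: "b \<in> S" "b \<le> a" for a b
  proof -
    obtain j where j: "j \<ge> 1" "exp (t * real j) < real (card (l1_ball j (b * real j)))"
      using ab(1) by (auto simp: S_def)
    have "card (l1_ball j (b * real j)) \<le> card (l1_ball j (a * real j))"
      using ab by (intro card_l1_ball_mono mult_right_mono) auto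
    with j have "exp (t * real j) < real (card (l1_ball j (a * real j)))"
      by linarith
    with j ab show ?thesis by (auto simp: S_def)
  qed
  have bdd: "bdd_below S"
    by (auto simp: S_def bdd_below_def)
  obtain c where "c \<ge> 0" and c: "\<And>k. exp ((t + 1) * real k) \<le> real (card (l1_ball k (c * real k)))"
    using card_l1_ball_rate_unbounded by metis
  have "exp (t * real 1) < exp ((t + 1) * real 1)"
    by simp
  with c[of 1] \<open>c \<ge> 0\<close> have "c \<in> S"
    unfolding S_def by (intro CollectI conjI exI[of _ 1]) linarith+
  then have ne: "S \<noteq> {}" by blast
  define \<alpha> where "\<alpha> = Inf S"
  obtain a0 where "a0 > 0" and a0: "\<And>k. real (card (l1_ball k (a0 * real k))) \<le> exp (t * real k)"
    using small_slope_bound[OF assms] by blast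
  have "a0 \<notin> S"
    using a0 by (auto simp: S_def not_less)
  then have "a0 \<le> \<alpha>"
    unfolding \<alpha>_def using up by (intro cInf_greatest[OF ne]) (metis nle_le)
  with \<open>a0 > 0\<close> have "\<alpha> > 0" by simp
  moreover have "\<exists>u>t. \<exists>j. \<forall>k. exp (u * (real k - real j)) \<le> real (card (l1_ball k (a * real k)))"
    if a: "a > \<alpha>" for a
  proof -
    obtain b where "b \<in> S" "b < a"
      using a cInf_less_iff[OF ne bdd] by (auto simp: \<alpha>_def)
    then have "a \<in> S" using up by auto
    then obtain j where "j \<ge> 1" "a \<ge> 0" "exp (t * real j) < real (card (l1_ball j (a * real j)))"
      by (auto simp: S_def)
    then show ?thesis
      using supercritical_growth[of j a t] assms by (metis less_imp_le)
  qed
  moreover have "\<exists>d>0. \<forall>k. real (card (l1_ball k (a * real k))) \<le> exp ((t - d) * real k)"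
    if "a < \<alpha>" for a
  proof -
    define b where "b = (max a 0 + \<alpha>) / 2"
    have b: "a < b" "0 \<le> b" "b < \<alpha>"
      using that \<open>\<alpha> > 0\<close> by (auto simp: b_def max_def)
    have "b \<notin> S"
      using b cInf_lower[OF _ bdd] by (force simp: \<alpha>_def)
    \<comment> \<open>Membership in \<open>S\<close> says nothing about dimension 0, where the ball is a single point.\<close>
    have "real (card (l1_ball k (b * real k))) \<le> exp (t * real k)" for k
    proof (cases "k = 0")
      case True
      then show ?thesis by (simp add: l1_ball_def)
    next
      case False
      with \<open>b \<notin> S\<close> b show ?thesis by (auto simp: S_def not_less)
    qed
    with \<open>a < b\<close> show ?thesis
      using subcritical_decay by metis
  qed
  ultimately show ?thesis by (rule that)
qed

section \<open>Asymptotics\<close>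

lemma min_radius_bounds:
  assumes "real n * exp w \<le> real (card (l1_ball k y))" "real (card (l1_ball k x)) < real n * exp w"
    and "x \<ge> 0"
  shows "x < real_of_int (min_radius n k w)" "real_of_int (min_radius n k w) \<le> y"
proof -
  define P where "P = (\<lambda>R::int. real n * exp w \<le> real (card (l1_ball k (real_of_int R))))"
  have large: "x < real_of_int R" if "P R" for R
  proof (rule ccontr)
    assume "\<not> x < real_of_int R"
    then have "card (l1_ball k (real_of_int R)) \<le> card (l1_ball k x)"
      by (intro card_l1_ball_mono) simp
    with that assms(2) show False by (simp add: P_def)
  qed
  have Py: "P \<lfloor>y\<rfloor>"
    using assms(1) by (simp add: P_def l1_ball_floor)
  have nonneg: "R \<ge> 0" if "P R" for R
    using large[OF that] assms(3) by linarith
  define m where "m = (LEAST m. P (int m))"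
  have "P (int (nat \<lfloor>y\<rfloor>))"
    unfolding nat_0_le[OF nonneg[OF Py]] by (rule Py)
  then have Pm: "P (int m)"
    unfolding m_def by (rule LeastI)
  have least: "int m \<le> R" if "P R" for R
    using Least_le[of "\<lambda>m. P (int m)" "nat R"] that nonneg[OF that] by (simp add: m_def)
  have "min_radius n k w = int m"
    unfolding min_radius_def using Pm least by (intro Least_equality) (auto simp: P_def)
  then show "x < real_of_int (min_radius n k w)" "real_of_int (min_radius n k w) \<le> y"
    using large[OF Pm] least[OF Py] by (simp_all add: le_floor_iff)
qed

lemma filterlim_ln_nat: "filterlim (\<lambda>n. ln (real n)) at_top at_top"
  by (rule filterlim_compose[OF ln_at_top filterlim_real_sequentially])

text \<open>
  Since \<open>k n / ln n\<close> tends to \<open>\<lambda>\<close>, the exponent \<open>(1/\<lambda> - d) k n - ln n\<close> is \<open>ln n\<close> times a factor with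
  the negative limit \<open>- d \<lambda>\<close>; in \<open>supercritical_eventually\<close> the corresponding limit is positive.
\<close>

lemma subcritical_smallo:
  fixes f :: "nat \<Rightarrow> real" and k :: "nat \<Rightarrow> nat"
  assumes lim: "((\<lambda>n. real (k n) / ln (real n)) \<longlongrightarrow> lam) at_top"
    and "lam > 0" "d > 0" and f: "\<And>n. \<bar>f n\<bar> \<le> exp ((1 / lam - d) * real (k n))"
  shows "f \<in> o(\<lambda>n. real n)"
proof -
  define e where "e = (\<lambda>n. ((1 / lam - d) * (real (k n) / ln (real n)) - 1) * ln (real n))"
  have "((\<lambda>n. (1 / lam - d) * (real (k n) / ln (real n)) - 1) \<longlongrightarrow> (1 / lam - d) * lam - 1) at_top"
    by (intro tendsto_intros lim)
  moreover have "(1 / lam - d) * lam - 1 < 0"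
    using assms by (simp add: algebra_simps)
  ultimately have "filterlim e at_bot at_top"
    unfolding e_def by (rule filterlim_tendsto_neg_mult_at_bot[OF _ _ filterlim_ln_nat])
  then have lim0: "((\<lambda>n. exp (e n)) \<longlongrightarrow> 0) at_top"
    by (rule filterlim_compose[OF exp_at_bot])
  have "eventually (\<lambda>n. norm (f n / real n) \<le> norm (exp (e n)) * 1) at_top"
    using eventually_gt_at_top[of 1]
  proof eventually_elim
    case (elim n)
    then have "ln (real n) \<noteq> 0" by simp
    then have "e n = (1 / lam - d) * real (k n) - ln (real n)"
      by (simp only: e_def left_diff_distrib) simp
    then have "exp (e n) = exp ((1 / lam - d) * real (k n)) / real n"
      using elim by (simp add: exp_diff)
    with f[of n] show ?case
      by (simp add: divide_right_mono)
  qed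
  then have "((\<lambda>n. f n / real n) \<longlongrightarrow> 0) at_top"
    by (rule tendsto_0_le[OF lim0])
  then show ?thesis
    by (intro smalloI_tendsto eventually_mono[OF eventually_gt_at_top[of 0]]) auto
qed

lemma supercritical_eventually:
  fixes k :: "nat \<Rightarrow> nat"
  assumes lim: "((\<lambda>n. real (k n) / ln (real n)) \<longlongrightarrow> lam) at_top"
    and "lam > 0" "u > 1 / lam" and \<omega>: "((\<lambda>n. \<omega> n / ln (real n)) \<longlongrightarrow> 0) at_top"
  shows "eventually (\<lambda>n. real n * exp (\<omega> n) \<le> exp (u * (real (k n) - c))) at_top"
proof -
  have "((\<lambda>n. c / ln (real n)) \<longlongrightarrow> 0) at_top"
    by (intro real_tendsto_divide_at_top[OF tendsto_const filterlim_ln_nat])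
  then have "((\<lambda>n. u * (real (k n) / ln (real n) - c / ln (real n)) - \<omega> n / ln (real n)) \<longlongrightarrow>
      u * (lam - 0) - 0) at_top"
    by (intro tendsto_intros lim \<omega>)
  moreover have "u * (lam - 0) - 0 > 1"
    using assms by (simp add: field_simps)
  ultimately have "eventually (\<lambda>n. u * (real (k n) / ln (real n) - c / ln (real n)) -
      \<omega> n / ln (real n) > 1) at_top"
    by (rule order_tendstoD)
  then show ?thesis
    using eventually_gt_at_top[of 1]
  proof eventually_elim
    case (elim n)
    then have L: "ln (real n) > 0" by simp
    have "u * (real (k n) / ln (real n) - c / ln (real n)) - \<omega> n / ln (real n) =
        (u * (real (k n) - c) - \<omega> n) / ln (real n)"
      by (simp add: diff_divide_distrib right_diff_distrib)
    with elim(1) have "1 < (u * (real (k n) - c) - \<omega> n) / ln (real n)"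
      by simp
    with L have "ln (real n) + \<omega> n \<le> u * (real (k n) - c)"
      by (simp add: less_divide_eq)
    then have "exp (ln (real n) + \<omega> n) \<le> exp (u * (real (k n) - c))"
      by simp
    with elim(2) show ?case by (simp add: exp_add)
  qed
qed

lemma asymp_equivI_sandwich:
  fixes f g :: "nat \<Rightarrow> real"
  assumes pos: "eventually (\<lambda>n. g n > 0) at_top"
    and "\<And>\<epsilon>. \<epsilon> \<in> {0<..<1} \<Longrightarrow>
      eventually (\<lambda>n. (1 - \<epsilon>) * g n \<le> f n \<and> f n \<le> (1 + \<epsilon>) * g n) at_top"
  shows "f \<sim>[at_top] g"
proof (rule asymp_equivI', rule tendstoI)
  fix e :: real
  assume "e > 0"
  define \<epsilon> where "\<epsilon> = min (e / 2) (1 / 2)"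
  have \<epsilon>: "\<epsilon> \<in> {0<..<1}" "\<epsilon> < e"
    using \<open>e > 0\<close> by (auto simp: \<epsilon>_def min_def)
  show "eventually (\<lambda>n. dist (f n / g n) 1 < e) at_top"
    using assms(2)[OF \<epsilon>(1)] pos
  proof eventually_elim
    case (elim n)
    then have "1 - \<epsilon> \<le> f n / g n" "f n / g n \<le> 1 + \<epsilon>"
      by (auto simp: field_simps)
    with \<epsilon> show ?case by (auto simp: dist_real_def abs_if)
  qed
qed

theorem lemmaE:
  fixes lam :: real and k :: "nat \<Rightarrow> nat"
  assumes "lam > 0"
    and "(\<lambda>n. real (k n)) \<sim>[at_top] (\<lambda>n. lam * ln (real n))"
  shows "\<exists>\<alpha> :: real.
    (\<exists>\<omega> :: nat \<Rightarrow> real. filterlim \<omega> at_top at_top \<and>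
      (\<forall>\<epsilon>\<in>{0<..<1}.
        (\<lambda>n. real_of_int (min_radius n (k n) (\<omega> n))) \<sim>[at_top] (\<lambda>n. \<alpha> * real (k n)) \<and>
        (\<lambda>n. \<alpha> * real (k n)) \<sim>[at_top] (\<lambda>n. \<alpha> * lam * ln (real n)) \<and>
        (\<lambda>n. real (card (l1_ball (k n) (\<alpha> * real (k n) * (1 - \<epsilon>))))) \<in> o(\<lambda>n. real n))) \<and>
    (\<forall>\<omega> :: nat \<Rightarrow> real. filterlim \<omega> at_top at_top \<and> \<omega> \<in> o(\<lambda>n. real (k n)) \<longrightarrow>
      (\<forall>\<epsilon>\<in>{0<..<1}.
        (\<lambda>n. real_of_int (min_radius n (k n) (\<omega> n))) \<sim>[at_top] (\<lambda>n. \<alpha> * real (k n)) \<and>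
        (\<lambda>n. \<alpha> * real (k n)) \<sim>[at_top] (\<lambda>n. \<alpha> * lam * ln (real n)) \<and>
        (\<lambda>n. real (card (l1_ball (k n) (\<alpha> * real (k n) * (1 - \<epsilon>))))) \<in> o(\<lambda>n. real n)))"
proof -
  let ?t = "1 / lam"
  obtain \<alpha> where \<alpha>: "\<alpha> > 0"
    and super: "\<And>a. a > \<alpha> \<Longrightarrow>
      \<exists>u>?t. \<exists>j. \<forall>k. exp (u * (real k - real j)) \<le> real (card (l1_ball k (a * real k)))"
    and sub: "\<And>a. a < \<alpha> \<Longrightarrow>
      \<exists>d>0. \<forall>k. real (card (l1_ball k (a * real k))) \<le> exp ((?t - d) * real k)"
    using critical_slope[of ?t] assms(1) by (metis zero_less_divide_1_iff)
  have ev_ln: "eventually (\<lambda>n. ln (real n) > 0) at_top"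
    using filterlim_ln_nat by (simp add: filterlim_at_top_dense)
  have "((\<lambda>n. real (k n) / (lam * ln (real n))) \<longlongrightarrow> 1) at_top"
    using assms(1)
    by (intro asymp_equivD_strong[OF assms(2)] eventually_mono[OF ev_ln]) auto
  from tendsto_mult[OF tendsto_const[of lam] this]
  have lim: "((\<lambda>n. real (k n) / ln (real n)) \<longlongrightarrow> lam) at_top"
    using assms(1) by simp
  have "filterlim (\<lambda>n. real (k n) / ln (real n) * ln (real n)) at_top at_top"
    by (rule filterlim_tendsto_pos_mult_at_top[OF lim assms(1) filterlim_ln_nat])
  then have k_top: "filterlim (\<lambda>n. real (k n)) at_top at_top"
    by (rule filterlim_mono_eventually[OF _ order_refl order_refl])
      (use ev_ln in \<open>eventually_elim; simp\<close>)
  then have k_pos: "eventually (\<lambda>n. real (k n) > 0) at_top"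
    unfolding filterlim_at_top_dense by blast

  have small: "(\<lambda>n. real (card (l1_ball (k n) (\<alpha> * real (k n) * (1 - \<epsilon>))))) \<in> o(\<lambda>n. real n)"
    if "\<epsilon> \<in> {0<..<1}" for \<epsilon>
  proof -
    have "\<alpha> * (1 - \<epsilon>) < \<alpha>"
      using \<alpha> that by (simp add: algebra_simps)
    then obtain d where "d > 0"
      and d: "\<And>k. real (card (l1_ball k (\<alpha> * (1 - \<epsilon>) * real k))) \<le> exp ((?t - d) * real k)"
      using sub by blast
    have "\<bar>real (card (l1_ball (k n) (\<alpha> * real (k n) * (1 - \<epsilon>))))\<bar>
        \<le> exp ((?t - d) * real (k n))" for n
      using d[of "k n"] by (simp add: mult_ac)
    then show ?thesis
      by (rule subcritical_smallo[OF lim assms(1) \<open>d > 0\<close>])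
  qed

  have radius: "(\<lambda>n. real_of_int (min_radius n (k n) (\<omega> n))) \<sim>[at_top] (\<lambda>n. \<alpha> * real (k n))"
    if \<omega>: "filterlim \<omega> at_top at_top" "\<omega> \<in> o(\<lambda>n. real (k n))" for \<omega> :: "nat \<Rightarrow> real"
  proof (rule asymp_equivI_sandwich)
    show "eventually (\<lambda>n. \<alpha> * real (k n) > 0) at_top"
      using k_pos by eventually_elim (use \<alpha> in simp)
  next
    fix \<epsilon> :: real
    assume \<epsilon>: "\<epsilon> \<in> {0<..<1}"
    have "((\<lambda>n. \<omega> n / real (k n) * (real (k n) / ln (real n))) \<longlongrightarrow> 0 * lam) at_top"
      by (intro tendsto_mult smalloD_tendsto[OF \<omega>(2)] lim)
    then have "((\<lambda>n. \<omega> n / real (k n) * (real (k n) / ln (real n))) \<longlongrightarrow> 0) at_top"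
      by simp
    then have lim\<omega>: "((\<lambda>n. \<omega> n / ln (real n)) \<longlongrightarrow> 0) at_top"
      by (rule Lim_transform_eventually) (use k_pos in \<open>eventually_elim; simp\<close>)
    have "\<alpha> * (1 + \<epsilon>) > \<alpha>"
      using \<alpha> \<epsilon> by (simp add: algebra_simps)
    then obtain u j where "u > ?t"
      and u: "\<And>k. exp (u * (real k - real j)) \<le> real (card (l1_ball k (\<alpha> * (1 + \<epsilon>) * real k)))"
      using super by blast
    have ev_super: "eventually (\<lambda>n. real n * exp (\<omega> n) \<le> exp (u * (real (k n) - real j))) at_top"
      by (rule supercritical_eventually[OF lim assms(1) \<open>u > ?t\<close> lim\<omega>])
    have ev_sub: "eventually (\<lambda>n. norm (real (card (l1_ball (k n) (\<alpha> * real (k n) * (1 - \<epsilon>)))))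
        \<le> 1 / 2 * norm (real n)) at_top"
      by (rule landau_o.smallD[OF small[OF \<epsilon>]]) simp
    have ev_\<omega>: "eventually (\<lambda>n. \<omega> n > 0) at_top"
      using \<omega>(1) by (simp add: filterlim_at_top_dense)
    show "eventually (\<lambda>n. (1 - \<epsilon>) * (\<alpha> * real (k n)) \<le> real_of_int (min_radius n (k n) (\<omega> n)) \<and>
        real_of_int (min_radius n (k n) (\<omega> n)) \<le> (1 + \<epsilon>) * (\<alpha> * real (k n))) at_top"
      using ev_super ev_sub ev_\<omega> eventually_gt_at_top[of 0]
    proof eventually_elim
      case (elim n)
      have "real n * 1 \<le> real n * exp (\<omega> n)"
        using elim(3) by (intro mult_left_mono) auto
      moreover have "real (card (l1_ball (k n) (\<alpha> * real (k n) * (1 - \<epsilon>)))) < real n"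
        using elim(2,4) by simp
      ultimately have lo: "real (card (l1_ball (k n) (\<alpha> * real (k n) * (1 - \<epsilon>)))) < real n * exp (\<omega> n)"
        by linarith
      have hi: "real n * exp (\<omega> n) \<le> real (card (l1_ball (k n) (\<alpha> * (1 + \<epsilon>) * real (k n))))"
        using elim(1) u[of "k n"] by linarith
      have "0 \<le> \<alpha> * real (k n) * (1 - \<epsilon>)"
        using \<alpha> \<epsilon> by simp
      from min_radius_bounds[OF hi lo this] show ?case
        by (simp add: mult_ac)
    qed
  qed

  have dim: "(\<lambda>n. \<alpha> * real (k n)) \<sim>[at_top] (\<lambda>n. \<alpha> * lam * ln (real n))"
    using asymp_equiv_mult[OF asymp_equiv_refl[of "\<lambda>_. \<alpha>"] assms(2)] by (simp add: mult.assoc)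

  define \<omega>0 where "\<omega>0 = (\<lambda>n. sqrt (real (k n)))"
  have \<omega>0: "filterlim \<omega>0 at_top at_top"
    unfolding \<omega>0_def by (rule filterlim_compose[OF sqrt_at_top k_top])
  then have "((\<lambda>n. inverse (\<omega>0 n)) \<longlongrightarrow> 0) at_top"
    by (rule tendsto_inverse_0_at_top)
  then have "((\<lambda>n. \<omega>0 n / real (k n)) \<longlongrightarrow> 0) at_top"
    by (rule Lim_transform_eventually)
      (use k_pos in \<open>eventually_elim; simp add: \<omega>0_def field_simps\<close>)
  then have "\<omega>0 \<in> o(\<lambda>n. real (k n))"
    by (intro smalloI_tendsto eventually_mono[OF k_pos]) auto
  with \<omega>0 show ?thesis
    by (intro exI[of _ \<alpha>] conjI exI[of _ \<omega>0]) (auto intro: radius small dim)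
qed

end
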